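(* Let $G$ be a finite simple graph with no triangles and no 4-cycles, with $n\ge3$ vertices and $m$ edges. For each $i$ let $n_i$ be the number of vertices of 2-distance degree $i$, and let $d$ and $D$ be the minimum and maximum 2-distance degree. Assume $d\ne0$, $D-d\ge2$, and $M_1-2m-nd=q(D-d)+r$, where $M_1=\sum_u d(u)^2$, $q$ is a positive integer and $r$ is an integer with $0\le r\le D-d-1$. Let $\alpha\in\mathbb{R}$, $\alpha\notin\{0,1\}$, and $S_\alpha=\frac{D^\alpha-d^\alpha}{D-d}$. Then: (1) If $r=0$ and $n_D=q$, then every vertex of $G$ has 2-distance degree $d$ or $D$. (2) If $r\ge1$ and $n_D=q$, then $n_i=0$ for $d+r+1\le i\le D-1$ and $n_{d+r}\le1$. (3) If $r\ge1$, $n_{d+r}\ne0$, and ($\alpha<0$ or $\alpha>1$), then $LM_1^\alpha(G)\le nd^\alpha+(M_1-2m-nd)S_\alpha+\big((d+r)^\alpha-d^\alpha-rS_\alpha\big)$. (4) If $r\ge1$, $n_{d+r}\ne0$, and $0<\alpha<1$, then $LM_1^\alpha(G)\ge nd^\alpha+(M_1-2m-nd)S_\alpha+\big((d+r)^\alpha-d^\alpha-rS_\alpha\big)$. In (3) and (4), equality holds if $G$ has $q$ vertices of 2-distance degree $D$, exactly one vertex of 2-distance degree $d+r$, and $n-q-1$ vertices of 2-distance degree $d$.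
   Context: For a vertex $u$, $d(u)$ is its degree and $d_2(u)$ (its 2-distance degree) is the number of vertices at distance exactly 2 from $u$. The general first leap Zagreb index is $LM_1^\alpha(G)=\sum_{u\in V(G)}d_2(u)^\alpha$. *)

theory Defs
  imports Complex_Main "Graph_Theory.Graph_Theory"
begin

text \<open>A finite simple graph is a term satisfying the locale predicate \<^locale>\<open>graph\<close>, i.e. a finite,
  loop-free symmetric digraph without parallel arcs. Each undirected edge is represented by two
  opposite arcs, so the degree of a vertex is its \<^const>\<open>out_degree\<close>.\<close>

definition edge_count :: "('a, 'b) pre_digraph \<Rightarrow> nat" where
  "edge_count G = card ((\<lambda>e. {tail G e, head G e}) ` arcs G)"

definition has_cycle_of_length :: "('a, 'b) pre_digraph \<Rightarrow> nat \<Rightarrow> bool" where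
  "has_cycle_of_length G k \<longleftrightarrow> (\<exists>p. pre_digraph.cycle G p \<and> length p = k)"

text \<open>The distance is the cost of a shortest walk under unit arc weights; it is \<open>\<infinity>\<close>
  between different components.\<close>

definition graph_dist :: "('a, 'b) pre_digraph \<Rightarrow> 'a \<Rightarrow> 'a \<Rightarrow> ereal" where
  "graph_dist G u v = wf_digraph.\<mu> G (\<lambda>_. 1) u v"

definition dist2_degree :: "('a, 'b) pre_digraph \<Rightarrow> 'a \<Rightarrow> nat" where
  "dist2_degree G u = card {v \<in> verts G. graph_dist G u v = 2}"

definition dist2_count :: "('a, 'b) pre_digraph \<Rightarrow> nat \<Rightarrow> nat" where
  "dist2_count G i = card {u \<in> verts G. dist2_degree G u = i}"

definition min_dist2_degree :: "('a, 'b) pre_digraph \<Rightarrow> nat" where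
  "min_dist2_degree G = Min (dist2_degree G ` verts G)"

definition max_dist2_degree :: "('a, 'b) pre_digraph \<Rightarrow> nat" where
  "max_dist2_degree G = Max (dist2_degree G ` verts G)"

definition first_zagreb :: "('a, 'b) pre_digraph \<Rightarrow> nat" where
  "first_zagreb G = (\<Sum>u\<in>verts G. (out_degree G u)\<^sup>2)"

text \<open>Since \<open>0 powr \<alpha> = 0\<close> for every \<open>\<alpha>\<close>, the following agrees with the usual
  convention for \<open>\<alpha> \<le> 0\<close> only if no vertex has 2-distance degree 0.\<close>

definition leap_zagreb :: "real \<Rightarrow> ('a, 'b) pre_digraph \<Rightarrow> real" where
  "leap_zagreb \<alpha> G = (\<Sum>u\<in>verts G. real (dist2_degree G u) powr \<alpha>)"

end

theory Submission
  imports Defs "HOL-Analysis.Convex"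
begin

text \<open>A vertex at distance 2 from \<open>u\<close> is reached through a unique neighbour of \<open>u\<close>
  (there are no 4-cycles), and conversely every neighbour of a neighbour of \<open>u\<close>, other than
  \<open>u\<close> itself, is at distance 2 (there are no triangles). Hence the 2-distance degree of \<open>u\<close> is the sum of
  \<open>deg v - 1\<close> over its neighbours \<open>v\<close>, and double counting gives
  \<open>(\<Sum>u. d\<^sub>2 u) = M\<^sub>1 - 2 m\<close>. The excesses \<open>d\<^sub>2 u - d\<close> therefore add up to
  \<open>q (D - d) + r\<close>: if \<open>q\<close> vertices have excess \<open>D - d\<close>, the others share \<open>r\<close>. The bounds on the
  leap Zagreb index follow by comparing \<open>x powr \<alpha>\<close> with its chord over \<open>[d, D]\<close> at all vertices
  except one of 2-distance degree \<open>d + r\<close>.\<close>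

section \<open>Vertices at distance two\<close>

definition neighbours :: "('a, 'b) pre_digraph \<Rightarrow> 'a \<Rightarrow> 'a set" where
  "neighbours G u = {v. u \<rightarrow>\<^bsub>G\<^esub> v}"

lemma (in wf_digraph) neighbours_in_verts: "neighbours G u \<subseteq> verts G"
  by (auto simp: neighbours_def arcs_ends_conv)

lemma (in sym_digraph) neighbours_commute: "v \<in> neighbours G u \<longleftrightarrow> u \<in> neighbours G v"
  using arcs_ends_symmetric[OF sym_arcs] by (auto simp: neighbours_def)

text \<open>Without parallel arcs, an arc leaving \<open>u\<close> is determined by its
  head.\<close>

lemma (in nomulti_digraph) out_degree_eq_card_neighbours: "out_degree G u = card (neighbours G u)"
proof -
  have "neighbours G u = head G ` out_arcs G u"
    by (force simp: neighbours_def arcs_ends_conv out_arcs_def)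
  moreover have "inj_on (head G) (out_arcs G u)"
    by (auto intro!: inj_onI no_multi_arcs simp: out_arcs_def arc_to_ends_def)
  ultimately show ?thesis
    by (simp add: out_degree_def card_image)
qed

section \<open>Distance two via short walks\<close>

lemma (in wf_digraph) awalk_length_0_iff:
  "(\<exists>p. awalk u p v \<and> length p = 0) \<longleftrightarrow> u = v \<and> u \<in> verts G"
  by (auto simp: awalk_Nil_iff)

text \<open>Splitting off the first arc. Iterated, this turns walks of length 1 and 2 into
  statements about \<open>neighbours\<close>.\<close>

lemma (in wf_digraph) awalk_length_Suc_iff:
  "(\<exists>p. awalk u p v \<and> length p = Suc k) \<longleftrightarrow>
    (\<exists>w\<in>neighbours G u. \<exists>p. awalk w p v \<and> length p = k)"
proof
  assume "\<exists>p. awalk u p v \<and> length p = Suc k"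
  then obtain e p where "awalk u (e # p) v" "length p = k"
    by (auto simp: length_Suc_conv)
  moreover from this have "head G e \<in> neighbours G u" "awalk (head G e) p v"
    by (auto simp: neighbours_def arcs_ends_conv awalk_Cons_iff)
  ultimately show "\<exists>w\<in>neighbours G u. \<exists>p. awalk w p v \<and> length p = k"
    by blast
next
  assume "\<exists>w\<in>neighbours G u. \<exists>p. awalk w p v \<and> length p = k"
  then obtain w p where "w \<in> neighbours G u" and p: "awalk w p v" "length p = k"
    by blast
  then obtain e where "e \<in> arcs G" "tail G e = u" "head G e = w"
    by (auto simp: neighbours_def arcs_ends_conv)
  with p have "awalk u (e # p) v \<and> length (e # p) = Suc k"
    by (simp add: awalk_Cons_iff)
  then show "\<exists>p. awalk u p v \<and> length p = Suc k" ..
qed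

lemma (in wf_digraph) awalk_cost_unit: "awalk_cost (\<lambda>_. 1) p = real (length p)"
  by (induction p) auto

text \<open>With unit weights the distance is an infimum of walk lengths, so it equals 2 exactly
  when there are walks of length 2 but none of length 0 or 1.\<close>

lemma (in wf_digraph) graph_dist_eq_2_iff:
  assumes "u \<in> verts G"
  shows "graph_dist G u v = 2 \<longleftrightarrow>
    u \<noteq> v \<and> v \<notin> neighbours G u \<and> (\<exists>w\<in>neighbours G u. v \<in> neighbours G w)"
proof -
  let ?walk = "\<lambda>k. \<exists>p. awalk u p v \<and> length p = k"
  have dist: "graph_dist G u v = (INF p\<in>{p. awalk u p v}. ereal (real (length p)))"
    by (simp add: graph_dist_def \<mu>_def awalk_cost_unit)
  have two: "(2::ereal) = ereal (real 2)"
    by simp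
  have "graph_dist G u v = 2 \<longleftrightarrow> \<not> ?walk 0 \<and> \<not> ?walk 1 \<and> ?walk 2"
  proof
    assume d2: "graph_dist G u v = 2"
    have ge: "2 \<le> length p" if "awalk u p v" for p
    proof -
      have "ereal (real 2) \<le> ereal (real (length p))"
        using d2 that unfolding dist two by (metis (mono_tags, lifting) INF_lower mem_Collect_eq)
      then show ?thesis by simp
    qed
    \<comment> \<open>An infimum below 3 yields a walk with fewer than three arcs; by
      \<open>ge\<close> it has exactly two.\<close>
    have "graph_dist G u v < ereal (real 3)"
      unfolding d2 two by simp
    then obtain p where "awalk u p v" "length p < 3"
      unfolding dist INF_less_iff by auto
    with ge[of p] have "?walk 2"
      by (intro exI[of _ p]) auto
    with ge show "\<not> ?walk 0 \<and> \<not> ?walk 1 \<and> ?walk 2"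
      by force
  next
    assume walks: "\<not> ?walk 0 \<and> \<not> ?walk 1 \<and> ?walk 2"
    then obtain p where p: "awalk u p v" "length p = 2"
      by blast
    have ge: "2 \<le> length p'" if "awalk u p' v" for p'
      using walks that by (metis One_nat_def less_2_cases not_less)
    show "graph_dist G u v = 2"
      unfolding dist two
    proof (rule INF_eqI)
      fix y assume "\<And>p. p \<in> {p. awalk u p v} \<Longrightarrow> y \<le> ereal (real (length p))"
      from this[of p] p show "y \<le> ereal (real 2)" by simp
    qed (use ge in force)
  qed
  also have "\<dots> \<longleftrightarrow>
    u \<noteq> v \<and> v \<notin> neighbours G u \<and> (\<exists>w\<in>neighbours G u. v \<in> neighbours G w)"
    using assms neighbours_in_verts
    unfolding numeral_2_eq_2 One_nat_def awalk_length_Suc_iff awalk_length_0_iff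
    by blast
  finally show ?thesis .
qed

section \<open>Neighbourhoods without triangles and 4-cycles\<close>

lemma (in graph) no_triangle:
  assumes "\<not> has_cycle_of_length G 3" "v \<in> neighbours G u" "w \<in> neighbours G v"
  shows "w \<notin> neighbours G u"
proof
  assume "w \<in> neighbours G u"
  then have "u \<in> neighbours G w"
    by (simp add: neighbours_commute)
  with assms obtain e1 e2 e3
    where e: "e1 \<in> arcs G" "e2 \<in> arcs G" "e3 \<in> arcs G"
      "tail G e1 = u" "head G e1 = v" "tail G e2 = v" "head G e2 = w" "tail G e3 = w" "head G e3 = u"
    by (auto simp: neighbours_def arcs_ends_conv)
  \<comment> \<open>\<open>cycle\<close> requires distinctness of the visited vertices after the
    starting one. Any two of these three are joined by an arc, so the absence of loops
    suffices.\<close>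
  then have "distinct [v, w, u]"
    using no_loops[of e1] no_loops[of e2] no_loops[of e3] by auto
  with e have "cycle [e1, e2, e3]"
    by (auto simp: cycle_def awalk_def intro!: exI[of _ u])
  then have "has_cycle_of_length G 3"
    unfolding has_cycle_of_length_def by (intro exI[of _ "[e1, e2, e3]"]) simp
  with assms(1) show False ..
qed

lemma (in graph) no_4_cycle:
  assumes "\<not> has_cycle_of_length G 4"
    and "v \<in> neighbours G u" "w \<in> neighbours G v" "v' \<in> neighbours G u" "w \<in> neighbours G v'"
    and "u \<noteq> w"
  shows "v = v'"
proof (rule ccontr)
  assume neq: "v \<noteq> v'"
  from assms neighbours_commute have "v' \<in> neighbours G w" "u \<in> neighbours G v'"
    by auto
  with assms obtain e1 e2 e3 e4
    where e: "e1 \<in> arcs G" "e2 \<in> arcs G" "e3 \<in> arcs G" "e4 \<in> arcs G"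
      "tail G e1 = u" "head G e1 = v" "tail G e2 = v" "head G e2 = w"
      "tail G e3 = w" "head G e3 = v'" "tail G e4 = v'" "head G e4 = u"
    by (auto simp: neighbours_def arcs_ends_conv)
  \<comment> \<open>Consecutive vertices differ because there are no loops; the two diagonal pairs
    differ by \<open>neq\<close> and \<open>u \<noteq> w\<close>.\<close>
  then have "distinct [v, w, v', u]"
    using no_loops[of e1] no_loops[of e2] no_loops[of e3] no_loops[of e4] neq \<open>u \<noteq> w\<close> by auto
  with e have "cycle [e1, e2, e3, e4]"
    by (auto simp: cycle_def awalk_def intro!: exI[of _ u])
  then have "has_cycle_of_length G 4"
    unfolding has_cycle_of_length_def by (intro exI[of _ "[e1, e2, e3, e4]"]) simp
  with assms(1) show False ..
qed

text \<open>The sets \<open>neighbours G v - {u}\<close>, for \<open>v\<close> adjacent to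
  \<open>u\<close>, partition the vertices at distance 2: they avoid the neighbours of
  \<open>u\<close> for lack of triangles and each other for lack of 4-cycles.\<close>

lemma (in graph) dist2_degree_eq_sum_neighbours:
  assumes "\<not> has_cycle_of_length G 3" "\<not> has_cycle_of_length G 4" "u \<in> verts G"
  shows "dist2_degree G u = (\<Sum>v\<in>neighbours G u. out_degree G v - 1)"
proof -
  have fin: "finite (neighbours G v)" for v
    using neighbours_in_verts finite_verts by (rule finite_subset)
  have "{v \<in> verts G. graph_dist G u v = 2} = (\<Union>v\<in>neighbours G u. neighbours G v - {u})"
    using no_triangle[OF assms(1)] neighbours_in_verts
    unfolding graph_dist_eq_2_iff[OF assms(3)] by blast
  moreover have "(neighbours G v - {u}) \<inter> (neighbours G v' - {u}) = {}"
    if "v \<in> neighbours G u" "v' \<in> neighbours G u" "v \<noteq> v'" for v v'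
    using no_4_cycle[OF assms(2) that(1) _ that(2)] that(3) by blast
  then have "card (\<Union>v\<in>neighbours G u. neighbours G v - {u})
      = (\<Sum>v\<in>neighbours G u. card (neighbours G v - {u}))"
    by (intro card_UN_disjoint) (auto simp: fin)
  ultimately have "dist2_degree G u = (\<Sum>v\<in>neighbours G u. card (neighbours G v - {u}))"
    by (simp only: dist2_degree_def)
  \<comment> \<open>By symmetry \<open>u\<close> is a neighbour of \<open>v\<close>, so removing it
    lowers the cardinality by exactly one.\<close>
  also have "\<dots> = (\<Sum>v\<in>neighbours G u. out_degree G v - 1)"
    by (intro sum.cong refl)
      (simp add: out_degree_eq_card_neighbours card_Diff_singleton neighbours_commute[of u])
  finally show ?thesis .
qed

section \<open>Degree sums\<close>

text \<open>Double counting: by symmetry, \<open>f v\<close> occurs once for each neighbour of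
  \<open>v\<close>.\<close>

lemma (in graph) sum_sum_neighbours:
  fixes f :: "'a \<Rightarrow> nat"
  shows "(\<Sum>u\<in>verts G. \<Sum>v\<in>neighbours G u. f v) = (\<Sum>v\<in>verts G. out_degree G v * f v)"
proof -
  have nb: "neighbours G u = {v \<in> verts G. v \<in> neighbours G u}" for u
    using neighbours_in_verts by auto
  have "(\<Sum>u\<in>verts G. \<Sum>v\<in>neighbours G u. f v)
      = (\<Sum>u\<in>verts G. \<Sum>v\<in>{v \<in> verts G. v \<in> neighbours G u}. f v)"
    using nb by simp
  also have "\<dots> = (\<Sum>v\<in>verts G. \<Sum>u\<in>{u \<in> verts G. v \<in> neighbours G u}. f v)"
    by (rule sum.swap_restrict) simp_all
  also have "\<dots> = (\<Sum>v\<in>verts G. out_degree G v * f v)"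
  proof (rule sum.cong[OF refl])
    fix v
    have "{u \<in> verts G. v \<in> neighbours G u} = neighbours G v"
      using nb[of v] neighbours_commute by auto
    then show "(\<Sum>u\<in>{u \<in> verts G. v \<in> neighbours G u}. f v) = out_degree G v * f v"
      by (simp add: out_degree_eq_card_neighbours)
  qed
  finally show ?thesis .
qed

text \<open>The map from arcs to their unordered ends has fibres of size two: an arc and its
  reverse.\<close>

lemma (in graph) card_arcs_eq_twice_edge_count: "card (arcs G) = 2 * edge_count G"
proof -
  let ?ends = "\<lambda>e. {tail G e, head G e}"
  have fibre: "card {a \<in> arcs G. ?ends a = ?ends e} = 2" if "e \<in> arcs G" for e
  proof -
    have "\<exists>e'\<in>arcs G. tail G e = head G e' \<and> head G e = tail G e'"
      using sym_arcs that unfolding symmetric_conv by (rule bspec)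
    then obtain e' where e': "e' \<in> arcs G" "tail G e = head G e'" "head G e = tail G e'"
      by blast
    have "e \<noteq> e'"
      using no_loops[OF that] e' by auto
    moreover have "a = e \<or> a = e'" if "a \<in> arcs G" "?ends a = ?ends e" for a
      using no_multi_arcs[of a e] no_multi_arcs[of a e'] that \<open>e \<in> arcs G\<close> e'
      by (auto simp: doubleton_eq_iff arc_to_ends_def)
    with \<open>e \<in> arcs G\<close> e' have "{a \<in> arcs G. ?ends a = ?ends e} = {e, e'}"
      by auto
    ultimately show ?thesis by simp
  qed
  have "card (arcs G) = (\<Sum>a\<in>arcs G. 1)"
    by simp
  also have "\<dots> = (\<Sum>E\<in>?ends ` arcs G. \<Sum>a\<in>{a \<in> arcs G. ?ends a = E}. 1)"
    by (rule sum.image_gen) simp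
  also have "\<dots> = (\<Sum>E\<in>?ends ` arcs G. 2)"
  proof (rule sum.cong[OF refl])
    fix E assume "E \<in> ?ends ` arcs G"
    then obtain e where e: "e \<in> arcs G" "E = ?ends e"
      by blast
    show "(\<Sum>a\<in>{a \<in> arcs G. ?ends a = E}. 1) = (2::nat)"
      unfolding e(2) using fibre[OF e(1)] by (simp only: card_eq_sum)
  qed
  finally show ?thesis
    by (simp add: edge_count_def)
qed

lemma (in fin_digraph) sum_out_degree: "(\<Sum>u\<in>verts G. out_degree G u) = card (arcs G)"
proof -
  have "card (arcs G) = card (\<Union>u\<in>verts G. out_arcs G u)"
    by (rule arg_cong[of _ _ card]) (auto simp: out_arcs_def)
  also have "\<dots> = (\<Sum>u\<in>verts G. out_degree G u)"
    unfolding out_degree_def by (rule card_UN_disjoint) (auto simp: out_arcs_def)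
  finally show ?thesis ..
qed

lemma (in graph) sum_dist2_degree:
  assumes "\<not> has_cycle_of_length G 3" "\<not> has_cycle_of_length G 4"
  shows "(\<Sum>u\<in>verts G. dist2_degree G u) + 2 * edge_count G = first_zagreb G"
proof -
  have "(\<Sum>u\<in>verts G. dist2_degree G u)
      = (\<Sum>u\<in>verts G. \<Sum>v\<in>neighbours G u. out_degree G v - 1)"
    by (intro sum.cong refl dist2_degree_eq_sum_neighbours assms)
  also have "\<dots> = (\<Sum>u\<in>verts G. out_degree G u * (out_degree G u - 1))"
    by (rule sum_sum_neighbours)
  finally have "(\<Sum>u\<in>verts G. dist2_degree G u) + 2 * edge_count G
      = (\<Sum>u\<in>verts G. out_degree G u * (out_degree G u - 1) + out_degree G u)"
    by (simp add: sum.distrib sum_out_degree card_arcs_eq_twice_edge_count)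
  also have "\<dots> = first_zagreb G"
    unfolding first_zagreb_def
  proof (rule sum.cong[OF refl])
    \<comment> \<open>Degree 0 is a separate case because the subtraction is truncated
      there.\<close>
    show "out_degree G u * (out_degree G u - 1) + out_degree G u = (out_degree G u)\<^sup>2" for u
      by (cases "out_degree G u") (auto simp: power2_eq_square)
  qed
  finally show ?thesis .
qed

section \<open>Powers and chords\<close>

lemma powr_has_second_derivative:
  fixes x \<alpha> :: real
  assumes "x > 0"
  shows "((\<lambda>x. x powr \<alpha>) has_real_derivative \<alpha> * x powr (\<alpha> - 1)) (at x)"
    and "((\<lambda>x. \<alpha> * x powr (\<alpha> - 1)) has_real_derivative \<alpha> * (\<alpha> - 1) * x powr (\<alpha> - 2)) (at x)"
  using assms by (auto intro!: derivative_eq_intros simp: algebra_simps)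

text \<open>The sign of the second derivative is that of
  \<open>\<alpha> * (\<alpha> - 1)\<close>.\<close>

lemma powr_convex_on_pos:
  fixes \<alpha> :: real
  assumes "\<alpha> \<le> 0 \<or> \<alpha> \<ge> 1"
  shows "convex_on {0<..} (\<lambda>x. x powr \<alpha>)"
proof (rule f''_ge0_imp_convex[OF _ powr_has_second_derivative])
  show "0 \<le> \<alpha> * (\<alpha> - 1) * x powr (\<alpha> - 2)" for x
    using assms by (auto simp: zero_le_mult_iff)
qed auto

lemma powr_concave_on_pos:
  fixes \<alpha> :: real
  assumes "0 \<le> \<alpha>" "\<alpha> \<le> 1"
  shows "concave_on {0<..} (\<lambda>x. x powr \<alpha>)"
proof (rule f''_le0_imp_concave[OF _ powr_has_second_derivative])
  show "\<alpha> * (\<alpha> - 1) * x powr (\<alpha> - 2) \<le> 0" for x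
    using assms by (auto simp: mult_le_0_iff)
qed auto

lemma powr_le_chord:
  fixes a b x \<alpha> :: real
  assumes "0 < a" "a \<le> x" "x \<le> b" "\<alpha> \<le> 0 \<or> \<alpha> \<ge> 1"
  shows "x powr \<alpha> \<le> a powr \<alpha> + (x - a) * ((b powr \<alpha> - a powr \<alpha>) / (b - a))"
proof -
  have "convex_on {a..b} (\<lambda>x. x powr \<alpha>)"
    using powr_convex_on_pos[OF assms(4)] assms(1) by (rule_tac convex_on_subset) auto
  from convex_onD_Icc'[OF this, of x] assms show ?thesis
    by (simp add: algebra_simps)
qed

lemma powr_ge_chord:
  fixes a b x \<alpha> :: real
  assumes "0 < a" "a \<le> x" "x \<le> b" "0 \<le> \<alpha>" "\<alpha> \<le> 1"
  shows "x powr \<alpha> \<ge> a powr \<alpha> + (x - a) * ((b powr \<alpha> - a powr \<alpha>) / (b - a))"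
proof -
  \<comment> \<open>Negation turns concavity into convexity; the sign is moved back at the
    end.\<close>
  have "convex_on {a..b} (\<lambda>x. - (x powr \<alpha>))"
    using powr_concave_on_pos[OF assms(4,5)] assms(1)
    unfolding concave_on_def by (rule_tac convex_on_subset) auto
  from convex_onD_Icc'[OF this, of x] assms
  have "- (x powr \<alpha>) \<le> (- (b powr \<alpha>) + a powr \<alpha>) / (b - a) * (x - a) - a powr \<alpha>"
    by simp
  also have "- (b powr \<alpha>) + a powr \<alpha> = - (b powr \<alpha> - a powr \<alpha>)"
    by simp
  finally show ?thesis
    unfolding minus_divide_left [symmetric] by (simp add: mult.commute)
qed

section \<open>Distribution of the excess\<close>

theorem theorem4p3:
  fixes G :: "('a, 'b) pre_digraph"
    and n m M\<^sub>1 d D q r :: nat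
    and \<alpha> S\<^sub>\<alpha> B :: real
  assumes "graph G"
    and "\<not> has_cycle_of_length G 3"
    and "\<not> has_cycle_of_length G 4"
    and "n = card (verts G)" and "n \<ge> 3"
    and "m = edge_count G"
    and "M\<^sub>1 = first_zagreb G"
    and "d = min_dist2_degree G" and "D = max_dist2_degree G"
    and "d \<noteq> 0" and "int D - int d \<ge> 2"
    and "int M\<^sub>1 - 2 * int m - int n * int d = int q * (int D - int d) + int r"
    and "q > 0"
    and "int r \<le> int D - int d - 1"
    and "\<alpha> \<notin> {0, 1}"
    and "S\<^sub>\<alpha> = (real D powr \<alpha> - real d powr \<alpha>) / (real D - real d)"
    and "B = real n * real d powr \<alpha> + (real M\<^sub>1 - 2 * real m - real n * real d) * S\<^sub>\<alpha>
             + (real (d + r) powr \<alpha> - real d powr \<alpha> - real r * S\<^sub>\<alpha>)"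
  shows
    "(r = 0 \<and> dist2_count G D = q \<longrightarrow>
        (\<forall>u\<in>verts G. dist2_degree G u = d \<or> dist2_degree G u = D)) \<and>
     (r \<ge> 1 \<and> dist2_count G D = q \<longrightarrow>
        (\<forall>i. d + r + 1 \<le> i \<and> i \<le> D - 1 \<longrightarrow> dist2_count G i = 0) \<and> dist2_count G (d + r) \<le> 1) \<and>
     (r \<ge> 1 \<and> dist2_count G (d + r) \<noteq> 0 \<and> (\<alpha> < 0 \<or> \<alpha> > 1) \<longrightarrow>
        leap_zagreb \<alpha> G \<le> B \<and>
        (dist2_count G D = q \<and> dist2_count G (d + r) = 1 \<and>
           int (dist2_count G d) = int n - int q - 1 \<longrightarrow> leap_zagreb \<alpha> G = B)) \<and>
     (r \<ge> 1 \<and> dist2_count G (d + r) \<noteq> 0 \<and> 0 < \<alpha> \<and> \<alpha> < 1 \<longrightarrow>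
        leap_zagreb \<alpha> G \<ge> B \<and>
        (dist2_count G D = q \<and> dist2_count G (d + r) = 1 \<and>
           int (dist2_count G d) = int n - int q - 1 \<longrightarrow> leap_zagreb \<alpha> G = B))"
proof -
  interpret graph G by fact
  let ?V = "verts G" and ?t = "dist2_degree G"
  let ?P = "\<lambda>x. real x powr \<alpha>"
  \<comment> \<open>The signed gap between the power and its chord over \<open>[d, D]\<close>. It
    vanishes at \<open>d\<close> and \<open>D\<close>, and \<open>g (d + r)\<close> is the bracketed
    correction term of \<open>B\<close>.\<close>
  define g where "g x = ?P x - ?P d - (real x - real d) * S\<^sub>\<alpha>" for x
  have dD: "d + r < D"
    using assms by linarith
  have bounds: "d \<le> ?t u" "?t u \<le> D" if "u \<in> ?V" for u
    using that assms by (auto simp: min_dist2_degree_def max_dist2_degree_def)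
  have total: "(\<Sum>u\<in>?V. ?t u) + 2 * m = M\<^sub>1"
    using sum_dist2_degree assms(2,3,6,7) by simp
  \<comment> \<open>Adding \<open>d\<close> back to each term undoes the subtraction, which is exact
    since \<open>d\<close> is the minimum.\<close>
  have "(\<Sum>u\<in>?V. ?t u - d) + n * d = (\<Sum>u\<in>?V. ?t u - d + d)"
    by (simp add: assms(4) sum.distrib)
  also have "\<dots> = (\<Sum>u\<in>?V. ?t u)"
    using bounds by (intro sum.cong) auto
  finally have "(\<Sum>u\<in>?V. ?t u - d) + n * d = (\<Sum>u\<in>?V. ?t u)" .
  moreover have "int q * (int D - int d) = int (q * (D - d))"
    using dD by (simp add: of_nat_diff)
  ultimately have excess: "(\<Sum>u\<in>?V. ?t u - d) = q * (D - d) + r"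
    using total assms(12) by (simp flip: of_nat_mult)
  \<comment> \<open>The \<open>q\<close> vertices of maximum degree use up
    \<open>q * (D - d)\<close> of the excess.\<close>
  have rest: "(\<Sum>u | u \<in> ?V \<and> ?t u \<noteq> D. ?t u - d) = r" if "dist2_count G D = q"
  proof -
    have "(\<Sum>u\<in>?V. ?t u - d) =
        (\<Sum>u | u \<in> ?V \<and> ?t u = D. ?t u - d) + (\<Sum>u | u \<in> ?V \<and> ?t u \<noteq> D. ?t u - d)"
      by (subst sum.union_disjoint[symmetric]) (auto intro!: sum.cong)
    moreover have "(\<Sum>u | u \<in> ?V \<and> ?t u = D. ?t u - d) = q * (D - d)"
      using that by (simp add: dist2_count_def)
    ultimately show ?thesis
      using excess by linarith
  qed
  have excess_le: "?t u - d \<le> r" if "dist2_count G D = q" "u \<in> ?V" "?t u \<noteq> D" for u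
    using member_le_sum[of u "{u \<in> ?V. ?t u \<noteq> D}" "\<lambda>u. ?t u - d"] rest that by simp
  have part1: "\<forall>u\<in>?V. ?t u = d \<or> ?t u = D" if "r = 0" "dist2_count G D = q"
    using excess_le bounds that by (fastforce intro: le_antisym)
  have part2: "dist2_count G i = 0"
    if "dist2_count G D = q" "d + r + 1 \<le> i" "i \<le> D - 1" for i
  proof -
    have "?t u \<noteq> i" if "u \<in> ?V" for u
      using excess_le[OF \<open>dist2_count G D = q\<close> that] \<open>d + r + 1 \<le> i\<close> \<open>i \<le> D - 1\<close> dD by linarith
    then show ?thesis
      by (auto simp: dist2_count_def)
  qed
  have part2': "dist2_count G (d + r) \<le> 1" if "r \<ge> 1" "dist2_count G D = q"
  proof -
    \<comment> \<open>Each vertex counted here takes the whole remaining excess \<open>r\<close>, so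
      there is room for only one.\<close>
    have "dist2_count G (d + r) * r = (\<Sum>u | u \<in> ?V \<and> ?t u = d + r. ?t u - d)"
      by (simp add: dist2_count_def)
    also have "\<dots> \<le> (\<Sum>u | u \<in> ?V \<and> ?t u \<noteq> D. ?t u - d)"
      using dD by (intro sum_mono2) auto
    finally show ?thesis
      using rest that by simp
  qed
  \<comment> \<open>The chord is affine, so its sum over all vertices depends only on
    \<open>n\<close> and the total 2-distance degree; the rest is the sum of the gaps.\<close>
  have leap: "leap_zagreb \<alpha> G = B + ((\<Sum>u\<in>?V. g (?t u)) - g (d + r))"
  proof -
    have "real (\<Sum>u\<in>?V. ?t u) = real M\<^sub>1 - 2 * real m"
      using total by linarith
    then have "(\<Sum>u\<in>?V. g (?t u)) =
        leap_zagreb \<alpha> G - real n * ?P d - (real M\<^sub>1 - 2 * real m - real n * real d) * S\<^sub>\<alpha>"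
      using assms(4)
      by (simp add: g_def leap_zagreb_def sum_subtractf flip: sum_distrib_right)
    then show ?thesis
      using assms(17) by (simp add: g_def)
  qed
  have eq: "leap_zagreb \<alpha> G = B"
    if "r \<ge> 1" and counts: "dist2_count G D = q" "dist2_count G (d + r) = 1"
      "int (dist2_count G d) = int n - int q - 1"
  proof -
    let ?U = "\<lambda>i. {u \<in> ?V. ?t u = i}"
    \<comment> \<open>The three disjoint classes have \<open>n\<close> elements together, hence
      exhaust the vertices.\<close>
    have "card (?U d \<union> ?U (d + r) \<union> ?U D) = card (?U d \<union> ?U (d + r)) + card (?U D)"
      using dD by (intro card_Un_disjoint) auto
    also have "card (?U d \<union> ?U (d + r)) = card (?U d) + card (?U (d + r))"
      using \<open>r \<ge> 1\<close> by (intro card_Un_disjoint) auto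
    also have "card (?U d) + card (?U (d + r)) + card (?U D) = card ?V"
      using counts assms(4) by (simp add: dist2_count_def)
    finally have V: "?V = ?U d \<union> ?U (d + r) \<union> ?U D"
      by (intro card_subset_eq[symmetric]) auto
    have g0: "g d = 0" "g D = 0"
      using dD assms(16) by (auto simp: g_def)
    \<comment> \<open>Only the single vertex of 2-distance degree \<open>d + r\<close> can have a
      nonzero gap.\<close>
    have "(\<Sum>u\<in>?V. g (?t u)) = (\<Sum>u\<in>?U (d + r). g (?t u))"
      using V g0 by (intro sum.mono_neutral_right) auto
    also have "\<dots> = g (d + r)"
      using counts by (simp add: dist2_count_def)
    finally show ?thesis
      using leap by simp
  qed
  obtain w where w: "w \<in> ?V" "?t w = d + r" if "dist2_count G (d + r) \<noteq> 0"
    by (cases "dist2_count G (d + r) = 0") (auto simp: dist2_count_def card_eq_0_iff)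
  \<comment> \<open>Removing \<open>w\<close> cancels the correction term, so the sign of
    \<open>g\<close> on the other vertices decides both bounds.\<close>
  have split: "(\<Sum>u\<in>?V. g (?t u)) - g (d + r) = (\<Sum>u\<in>?V - {w}. g (?t u))"
    if "dist2_count G (d + r) \<noteq> 0"
    using w[OF that] by (simp add: sum_diff1)
  have upper: "leap_zagreb \<alpha> G \<le> B"
    if "dist2_count G (d + r) \<noteq> 0" "\<alpha> < 0 \<or> \<alpha> > 1"
  proof -
    \<comment> \<open>\<open>d \<noteq> 0\<close> keeps the chord's interval inside the positive
      reals.\<close>
    have "g (?t u) \<le> 0" if "u \<in> ?V" for u
      using powr_le_chord[of "real d" "real (?t u)" "real D" \<alpha>] bounds[OF that] assms(10,16)
        \<open>\<alpha> < 0 \<or> \<alpha> > 1\<close> by (auto simp: g_def)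
    then show ?thesis
      using leap split[OF that(1)] sum_nonpos[of "?V - {w}" "\<lambda>u. g (?t u)"] by simp
  qed
  have lower: "leap_zagreb \<alpha> G \<ge> B"
    if "dist2_count G (d + r) \<noteq> 0" "0 < \<alpha>" "\<alpha> < 1"
  proof -
    have "g (?t u) \<ge> 0" if "u \<in> ?V" for u
      using powr_ge_chord[of "real d" "real (?t u)" "real D" \<alpha>] bounds[OF that] assms(10,16)
        \<open>0 < \<alpha>\<close> \<open>\<alpha> < 1\<close> by (auto simp: g_def)
    then show ?thesis
      using leap split[OF that(1)] sum_nonneg[of "?V - {w}" "\<lambda>u. g (?t u)"] by simp
  qed
  show ?thesis
    by (intro conjI impI allI) (use part2' in \<open>simp_all add: part1 part2 upper lower eq\<close>)
qed

end
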